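(* Let $\Delta$ be a nonpure simplicial complex. Then there is a simplicial complex $\Gamma\supseteq\Delta$ with $\dim(\Gamma)=\dim(\Delta)$ such that $\Gamma$ and $(\Gamma,\Delta)$ are both layer-compatibly partitionable (i.e., each of them has a layer-compatible partitioning).
   Context: All simplicial complexes are finite: a simplicial complex is a collection $\Delta$ of finite subsets of a finite ground set, closed under taking subsets. Its elements are faces, $\dim\sigma=|\sigma|-1$, $\dim\Delta$ is the maximal dimension of a face, and $\Delta$ is pure if all its maximal faces have the same dimension. The complex $\Gamma$ may use more vertices than $\Delta$. For a subcomplex $\Delta$ of a simplicial complex $\Gamma$, the relative complex $(\Gamma,\Delta)$ is the set of faces of $\Gamma$ not in $\Delta$. The face poset of a (relative) complex is its set of faces ordered by inclusion, and its facets are its maximal faces. An interval $[\sigma,\tau]=\{e : \sigma\le e\le\tau\}$ in a poset is Boolean if it is isomorphic to the poset of all subsets of a $k$-element set for some $k\ge0$. A partitioning of a (relative) complex $X$ is a decomposition of its face poset into disjoint Boolean intervals, the maximum of each of which is a facet of $X$; necessarily every facet $F$ of $X$ is the top of exactly one interval, so a partitioning can be written $\bigsqcup_{F\text{ facet of }X}[\Psi(F),F]$. Such a partitioning is layer-compatible if for every $0\le r\le\dim(X)$ the restriction \[ \bigsqcup_{F\text{ facet of }X,\ \dim(F)\ge r}[\Psi(F),F] \] is a partitioning of the set of all faces of $X$ that are contained in some facet of $X$ of dimension at least $r$ (for $X$ a simplicial complex, this is the subcomplex generated by the facets of dimension at least $r$). *)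

theory Defs
  imports Main "HOL-Library.Disjoint_Sets"
begin

definition finite_simplicial_complex :: "'a set set \<Rightarrow> bool" where
  "finite_simplicial_complex \<Delta> \<longleftrightarrow>
     (\<exists>V. finite V \<and> \<Delta> \<subseteq> Pow V) \<and> (\<forall>\<tau>\<in>\<Delta>. \<forall>\<sigma>. \<sigma> \<subseteq> \<tau> \<longrightarrow> \<sigma> \<in> \<Delta>)"

text \<open>The definitions below apply to an arbitrary set \<open>X\<close> of faces, so that they cover both
  complexes and relative complexes; the relative complex of \<open>\<Delta> \<subseteq> \<Gamma>\<close> is the set
  difference \<open>\<Gamma> - \<Delta>\<close>.\<close>

definition face_dim :: "'a set \<Rightarrow> int" where
  "face_dim \<sigma> = int (card \<sigma>) - 1"

text \<open>Every face has dimension at least \<open>-1\<close>, so inserting \<open>-1\<close> changes nothing unless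
  \<open>X\<close> has no faces at all, in which case the dimension is \<open>-1\<close> by convention.\<close>

definition complex_dim :: "'a set set \<Rightarrow> int" where
  "complex_dim X = Max (insert (-1) (face_dim ` X))"

definition facets :: "'a set set \<Rightarrow> 'a set set" where
  "facets X = {F \<in> X. \<forall>G\<in>X. F \<subseteq> G \<longrightarrow> G = F}"

definition pure_complex :: "'a set set \<Rightarrow> bool" where
  "pure_complex X \<longleftrightarrow> (\<forall>F\<in>facets X. \<forall>G\<in>facets X. face_dim F = face_dim G)"

definition face_interval :: "'a set set \<Rightarrow> 'a set \<Rightarrow> 'a set \<Rightarrow> 'a set set" where
  "face_interval X \<sigma> \<tau> = {e \<in> X. \<sigma> \<subseteq> e \<and> e \<subseteq> \<tau>}"

definition boolean_poset :: "'a set set \<Rightarrow> bool" where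
  "boolean_poset I \<longleftrightarrow>
     (\<exists>(k::nat) f. bij_betw f I (Pow {..<k}) \<and> (\<forall>x\<in>I. \<forall>y\<in>I. x \<subseteq> y \<longleftrightarrow> f x \<subseteq> f y))"

definition partitioning :: "'a set set \<Rightarrow> 'a set set set \<Rightarrow> bool" where
  "partitioning X P \<longleftrightarrow>
     partition_on X P \<and>
     (\<forall>I\<in>P. boolean_poset I \<and>
        (\<exists>\<sigma>\<in>X. \<exists>F\<in>facets X. \<sigma> \<subseteq> F \<and> I = face_interval X \<sigma> F))"

definition layer :: "'a set set \<Rightarrow> int \<Rightarrow> 'a set set" where
  "layer X r = {e \<in> X. \<exists>F\<in>facets X. r \<le> face_dim F \<and> e \<subseteq> F}"

definition is_top :: "'a set \<Rightarrow> 'a set set \<Rightarrow> bool" where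
  "is_top F I \<longleftrightarrow> F \<in> I \<and> (\<forall>e\<in>I. e \<subseteq> F)"

text \<open>In a partitioning, each facet is the top of exactly one interval, so restricting the
  partitioning to the facets of dimension at least \<open>r\<close> means keeping the intervals whose top is
  such a facet.\<close>

definition layer_compatible :: "'a set set \<Rightarrow> 'a set set set \<Rightarrow> bool" where
  "layer_compatible X P \<longleftrightarrow>
     partitioning X P \<and>
     (\<forall>r. 0 \<le> r \<and> r \<le> complex_dim X \<longrightarrow>
        partitioning (layer X r) {I \<in> P. \<exists>F\<in>facets X. r \<le> face_dim F \<and> is_top F I})"

definition layer_compatibly_partitionable :: "'a set set \<Rightarrow> bool" where
  "layer_compatibly_partitionable X \<longleftrightarrow> (\<exists>P. layer_compatible X P)"

end

theory Submission
  imports Defs "HOL-Library.Countable"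
begin

text \<open>
  Let \<open>n\<close> be the largest cardinality of a face of \<open>\<Delta>\<close>. The extension \<open>\<Gamma>\<close> is built to be pure, with
  all facets of size \<open>n\<close>, and so is \<open>\<Gamma> - \<Delta>\<close>. Then there is only one layer, and a partitioning is
  just a decomposition into intervals whose tops have size \<open>n\<close>; call a set of faces \<open>n\<close>-tiled if it
  has such a decomposition.

  The idea is to pay for each face \<open>\<rho>\<close> of \<open>\<Delta>\<close> separately: to \<open>\<rho>\<close> one glues a set \<open>G \<rho>\<close> of new faces
  such that both \<open>G \<rho>\<close> and \<open>G \<rho> \<union> {\<rho>}\<close> are \<open>n\<close>-tiled. If the new vertices used for different faces are
  different, then \<open>\<Gamma> - \<Delta>\<close> is the disjoint union of the sets \<open>G \<rho>\<close>, and \<open>\<Gamma>\<close> is the disjoint union of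
  the sets \<open>G \<rho> \<union> {\<rho>}\<close>, so both are \<open>n\<close>-tiled.

  To find \<open>G \<rho>\<close>, put \<open>k = n - card \<rho>\<close> and let \<open>D \<subseteq> C\<close> be the boundary complexes of cross-polytopes
  of dimensions \<open>k\<close> and \<open>k + 1\<close> on new vertices. With \<open>*\<close> for the join and \<open>\<partial>\<rho>\<close> for the set of proper
  subsets of \<open>\<rho>\<close>, take
  \<open>G \<rho> = \<partial>\<rho> * (C - {{}}) \<union> {\<rho>} * (D - {{}})\<close>, so that \<open>G \<rho> \<union> {\<rho>} = \<partial>\<rho> * (C - {{}}) \<union> {\<rho>} * D\<close>.
  Since \<open>D \<subseteq> C\<close>, adding the subsets of \<open>\<rho>\<close> to \<open>G \<rho>\<close> gives a complex. Joins of tiled sets are tiled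
  (\<open>tiled_join\<close>), and so is \<open>\<partial>\<rho>\<close>, the boundary of a simplex (\<open>tiled_boundary\<close>).
  What makes the construction work is that the boundary of a cross-polytope is tiled both with its
  empty face (\<open>tiled_cross\<close>) and without it (\<open>tiled_cross_minus_empty\<close>).

  For the latter, regard faces of the cross-polytope as words over \<open>{+, -, 0}\<close> and fill each \<open>0\<close> with
  the sign to its left, the leading zeros with an initial sign chosen in advance. The words that are
  completed to a given full word by this process form an interval. If every word is started with
  the same sign, this tiles the whole complex. If instead every word is started with the sign
  opposite to its own last sign, then all words are treated except the zero word, which has no last
  sign, and this tiles the complex without its empty face.
\<close>

section \<open>Tilings by Boolean intervals with tops of equal size\<close>

text \<open>The order on \<open>'a set\<close> is inclusion, so \<open>{b..F}\<close> is the Boolean interval from \<open>b\<close> to \<open>F\<close>. The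
  inductive form, adding one interval at a time, turns closure properties of tilings into inductions
  that never mention the blocks of a partition.\<close>

inductive tiled :: "nat \<Rightarrow> 'a set set \<Rightarrow> bool" for n where
  tiled_empty: "tiled n {}"
| tiled_add: "tiled n X \<Longrightarrow> b \<subseteq> F \<Longrightarrow> finite F \<Longrightarrow> card F = n \<Longrightarrow> X \<inter> {b..F} = {}
    \<Longrightarrow> tiled n (X \<union> {b..F})"

lemma tiled_interval:
  assumes "b \<subseteq> F" "finite F" "card F = n"
  shows "tiled n {b..F}"
  using tiled_add[OF tiled_empty assms] by simp

lemma tiled_Un:
  assumes "tiled n Y" "tiled n X" "X \<inter> Y = {}"
  shows "tiled n (X \<union> Y)"
  using assms
proof (induction rule: tiled.induct)
  case (tiled_add Y b F)
  then have "tiled n ((X \<union> Y) \<union> {b..F})"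
    by (intro tiled.tiled_add) auto
  then show ?case by (simp add: Un_assoc)
qed simp

lemma tiled_UN:
  assumes "finite I" "\<And>i. i \<in> I \<Longrightarrow> tiled n (A i)" "disjoint_family_on A I"
  shows "tiled n (\<Union>i\<in>I. A i)"
  using assms
proof (induction I rule: finite_induct)
  case (insert i I)
  have "tiled n (\<Union>i\<in>I. A i)"
    using insert.IH insert.prems by (auto simp: disjoint_family_on_def)
  moreover have "A i \<inter> (\<Union>i\<in>I. A i) = {}"
    using insert.prems(2) insert.hyps(2) by (fastforce simp: disjoint_family_on_def)
  ultimately show ?case
    using tiled_Un insert.prems(1)[of i] by fastforce
qed (simp add: tiled_empty)

lemma tiled_card_le: "tiled n X \<Longrightarrow> e \<in> X \<Longrightarrow> finite e \<and> card e \<le> n"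
proof (induction rule: tiled.induct)
  case (tiled_add X b F)
  then show ?case by (auto intro: card_mono finite_subset)
qed simp

lemma tiled_partition:
  assumes "tiled n X"
  shows "finite X \<and> (\<exists>P. partition_on X P \<and>
    (\<forall>I\<in>P. \<exists>b F. b \<subseteq> F \<and> finite F \<and> card F = n \<and> I = {b..F}))"
  using assms
proof (induction rule: tiled.induct)
  case tiled_empty
  then show ?case by (auto simp: partition_on_def)
next
  case (tiled_add X b F)
  then obtain P where P: "partition_on X P"
    "\<forall>I\<in>P. \<exists>b F. b \<subseteq> F \<and> finite F \<and> card F = n \<and> I = {b..F}" by blast
  have "finite {b..F}"
    using tiled_add.hyps(3) by (rule finite_subset[rotated, OF finite_Pow_iff[THEN iffD2]]) auto
  moreover have "partition_on (X \<union> {b..F}) (insert {b..F} P)"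
    using P(1) tiled_add.hyps(2,5) by (auto simp: partition_on_def disjoint_def)
  ultimately show ?case
    using P(2) tiled_add by (intro conjI exI[of _ "insert {b..F} P"]) auto
qed

lemma boolean_poset_interval:
  assumes "finite F" "b \<subseteq> F"
  shows "boolean_poset {b..F}"
proof -
  obtain h where h: "bij_betw h (F - b) {..<card (F - b)}"
    using ex_bij_betw_finite_nat[of "F - b"] assms(1) by (auto simp: atLeast0LessThan)
  have "bij_betw (\<lambda>e. e - b) {b..F} (Pow (F - b))"
    using assms(2) by (intro bij_betw_byWitness[where f' = "\<lambda>e. e \<union> b"]) auto
  from bij_betw_trans[OF this bij_betw_Pow[OF h]]
  have "bij_betw (\<lambda>e. h ` (e - b)) {b..F} (Pow {..<card (F - b)})"
    by (simp add: o_def)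
  moreover have "x \<subseteq> y \<longleftrightarrow> h ` (x - b) \<subseteq> h ` (y - b)"
    if "x \<in> {b..F}" "y \<in> {b..F}" for x y
  proof -
    have "h ` (x - b) \<subseteq> h ` (y - b) \<longleftrightarrow> x - b \<subseteq> y - b"
    proof
      assume sub: "h ` (x - b) \<subseteq> h ` (y - b)"
      show "x - b \<subseteq> y - b"
      proof
        fix p assume p: "p \<in> x - b"
        then obtain q where "q \<in> y - b" "h p = h q" using sub by blast
        then show "p \<in> y - b"
          using h that p by (auto simp: bij_betw_def dest: inj_onD[of h _ p q])
      qed
    qed (rule image_mono)
    then show ?thesis using that by auto
  qed
  ultimately show ?thesis
    unfolding boolean_poset_def by blast
qed

text \<open>Every face lies below a tile top of size \<open>n\<close>, and no face is larger than that; so the facets are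
  exactly the faces of size \<open>n\<close> and each layer up to the dimension of \<open>X\<close> is the whole of \<open>X\<close>.\<close>

lemma tiled_imp_layer_compatibly_partitionable:
  assumes "tiled n X"
  shows "layer_compatibly_partitionable X"
proof -
  have finX: "finite X" using tiled_partition[OF assms] ..
  obtain P where P: "partition_on X P"
    and blocks: "\<forall>I\<in>P. \<exists>b F. b \<subseteq> F \<and> finite F \<and> card F = n \<and> I = {b..F}"
    using tiled_partition[OF assms] by (elim conjE exE)
  note tile = blocks[rule_format]
  have top: "\<exists>F\<in>X. finite F \<and> card F = n \<and> e \<subseteq> F" if e: "e \<in> X" for e
  proof -
    obtain I where "I \<in> P" "e \<in> I" using partition_onD1[OF P] e by blast
    moreover from \<open>I \<in> P\<close> have "I \<subseteq> X" using partition_onD1[OF P] by blast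
    moreover obtain b F where "b \<subseteq> F" "finite F" "card F = n" "I = {b..F}"
      using tile[OF \<open>I \<in> P\<close>] by blast
    ultimately show ?thesis by (intro bexI[of _ F]) auto
  qed
  note card_le = tiled_card_le[OF assms]
  have facets: "F \<in> facets X" if "F \<in> X" "card F = n" for F
    using that card_le unfolding facets_def by (simp, metis card_seteq)
  have block: "\<exists>b F. b \<in> X \<and> F \<in> facets X \<and> card F = n \<and> b \<subseteq> F \<and> finite F \<and>
      I = {b..F} \<and> I = face_interval X b F" if I: "I \<in> P" for I
  proof -
    obtain b F where bF: "b \<subseteq> F" "finite F" "card F = n" "I = {b..F}" using tile[OF I] by blast
    have "I \<subseteq> X" using partition_onD1[OF P] I by blast
    then have "b \<in> X" "F \<in> X" "I = face_interval X b F"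
      using bF by (auto simp: face_interval_def)
    then show ?thesis using bF facets by blast
  qed
  have part: "partitioning X P"
    unfolding partitioning_def
  proof (intro conjI ballI)
    fix I assume "I \<in> P"
    then obtain b F where bF: "b \<in> X" "F \<in> facets X" "b \<subseteq> F" "finite F" "I = {b..F}"
      "I = face_interval X b F" using block by blast
    then show "boolean_poset I" using boolean_poset_interval by simp
    show "\<exists>\<sigma>\<in>X. \<exists>F\<in>facets X. \<sigma> \<subseteq> F \<and> I = face_interval X \<sigma> F"
      using bF by blast
  qed (rule P)
  have layer: "layer X r = X \<and> {I \<in> P. \<exists>F\<in>facets X. r \<le> face_dim F \<and> is_top F I} = P"
    if "0 \<le> r" "r \<le> complex_dim X" for r
  proof -
    \<comment> \<open>The maximum takes care of an empty \<open>X\<close>, for which \<open>n\<close> is arbitrary.\<close>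
    have "\<forall>x\<in>insert (-1) (face_dim ` X). x \<le> max (-1) (int n - 1)"
      using card_le by (fastforce simp: face_dim_def le_max_iff_disj)
    then have "complex_dim X \<le> max (-1) (int n - 1)"
      unfolding complex_dim_def using finX by (subst Max_le_iff) auto
    then have r: "r \<le> face_dim F" if "card F = n" for F :: "'a set"
      using that \<open>0 \<le> r\<close> \<open>r \<le> complex_dim X\<close> by (simp add: face_dim_def)
    have "layer X r = X"
    proof -
      have "\<exists>F\<in>facets X. r \<le> face_dim F \<and> e \<subseteq> F" if "e \<in> X" for e
        using top[OF that] r facets by blast
      then show ?thesis unfolding layer_def by blast
    qed
    moreover have "\<exists>F\<in>facets X. r \<le> face_dim F \<and> is_top F I" if I: "I \<in> P" for I
    proof -
      obtain b F where "F \<in> facets X" "card F = n" "b \<subseteq> F" "I = {b..F}"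
        using block[OF I] by blast
      then show ?thesis using r by (intro bexI[of _ F]) (auto simp: is_top_def)
    qed
    ultimately show ?thesis by blast
  qed
  show ?thesis
    unfolding layer_compatibly_partitionable_def layer_compatible_def
    using part layer by (intro exI[of _ P]) simp
qed

section \<open>Joins\<close>

definition join :: "'a set set \<Rightarrow> 'a set set \<Rightarrow> 'a set set" where
  "join A B = {a \<union> b | a b. a \<in> A \<and> b \<in> B}"

text \<open>With disjoint vertex sets, a face of the join determines both of its parts.\<close>

lemma join_disjoint:
  assumes "A \<union> A' \<subseteq> Pow U" "B \<union> B' \<subseteq> Pow W" "U \<inter> W = {}"
    and "A \<inter> A' = {} \<or> B \<inter> B' = {}"
  shows "join A B \<inter> join A' B' = {}"
proof -
  have "a = a' \<and> b = b'" if "a \<in> A" "b \<in> B" "a' \<in> A'" "b' \<in> B'" "a \<union> b = a' \<union> b'" for a b a' b'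
  proof -
    have "a = (a \<union> b) \<inter> U" "b = (a \<union> b) \<inter> W" "a' = (a' \<union> b') \<inter> U" "b' = (a' \<union> b') \<inter> W"
      using that(1-4) assms(1-3) by blast+
    then show ?thesis using that(5) by metis
  qed
  then show ?thesis
    using assms(4) unfolding join_def by blast
qed

lemma join_Un_left: "join (A \<union> A') B = join A B \<union> join A' B"
  and join_Un_right: "join A (B \<union> B') = join A B \<union> join A B'"
  by (auto simp: join_def)

lemma join_intervals:
  assumes "b \<subseteq> F" "c \<subseteq> G"
  shows "join {b..F} {c..G} = {b \<union> c..F \<union> G}"
proof
  show "{b \<union> c..F \<union> G} \<subseteq> join {b..F} {c..G}"
  proof
    fix e assume "e \<in> {b \<union> c..F \<union> G}"
    then have "e = (e \<inter> F) \<union> (e \<inter> G)" "e \<inter> F \<in> {b..F}" "e \<inter> G \<in> {c..G}"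
      using assms by auto
    then show "e \<in> join {b..F} {c..G}" unfolding join_def by blast
  qed
qed (auto simp: join_def)

text \<open>The joins of the tiles of \<open>A\<close> with the tiles of \<open>B\<close> are intervals, and they tile the join.\<close>

lemma tiled_join:
  assumes "tiled m A" "tiled n B" "A \<subseteq> Pow U" "B \<subseteq> Pow W" "U \<inter> W = {}"
  shows "tiled (m + n) (join A B)"
  using assms(1,3)
proof (induction rule: tiled.induct)
  case tiled_empty
  then show ?case by (simp add: join_def tiled.tiled_empty)
next
  case (tiled_add A b F)
  have "tiled (m + n) (join {b..F} B)"
    using assms(2,4)
  proof (induction rule: tiled.induct)
    case tiled_empty
    then show ?case by (simp add: join_def tiled.tiled_empty)
  next
    case (tiled_add B c G)
    note A = \<open>b \<subseteq> F\<close> \<open>finite F\<close> \<open>card F = m\<close> \<open>A \<union> {b..F} \<subseteq> Pow U\<close>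
    have "F \<in> {b..F}" "G \<in> {c..G}" using A tiled_add.hyps by auto
    then have "F \<subseteq> U" "G \<subseteq> W" using A tiled_add.prems by blast+
    then have "card (F \<union> G) = m + n"
      using A tiled_add.hyps assms(5) by (subst card_Un_disjoint) auto
    then have "tiled (m + n) (join {b..F} {c..G})"
      using A tiled_add.hyps by (subst join_intervals) (auto intro: tiled_interval)
    moreover have "join {b..F} B \<inter> join {b..F} {c..G} = {}"
      using A tiled_add.hyps tiled_add.prems assms(5) by (intro join_disjoint[of _ _ U _ _ W]) auto
    ultimately show ?case
      using tiled_add by (auto simp: join_Un_right intro: tiled_Un)
  qed
  moreover have "join A B \<inter> join {b..F} B = {}"
    using tiled_add.hyps tiled_add.prems assms(4,5) by (intro join_disjoint[of _ _ U _ _ W]) auto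
  ultimately show ?case
    using tiled_add by (auto simp: join_Un_left intro: tiled_Un)
qed

lemma insert_image_eq_join: "insert v ` A = join {{v}..{v}} A"
  by (auto simp: join_def)

lemma tiled_insert_image:
  assumes "tiled n A" "A \<subseteq> Pow W" "v \<notin> W"
  shows "tiled (Suc n) (insert v ` A)"
  using tiled_join[OF tiled_interval[of "{v}" "{v}" 1] assms(1) _ assms(2), of "{v}"] assms(3)
  by (simp add: insert_image_eq_join)

lemma tiled_cone:
  assumes "tiled n A" "A \<subseteq> Pow W" "v \<notin> W"
  shows "tiled (Suc n) (A \<union> insert v ` A)"
proof -
  have "tiled (1 + n) (join {{}..{v}} A)"
    using assms by (intro tiled_join[of _ _ _ _ "{v}" W] tiled_interval) auto
  moreover have "join {{}..{v}} A = A \<union> insert v ` A"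
    by (auto simp: join_def subset_singleton_iff)
  ultimately show ?thesis by simp
qed

text \<open>The boundary of a simplex is shellable. The induction adds a vertex \<open>x\<close>: the facet opposite to
  \<open>x\<close> is one tile, and the remaining faces contain \<open>x\<close> and form a cone over the smaller boundary
  without its base.\<close>

lemma tiled_boundary:
  assumes "finite \<rho>" "card \<rho> = Suc m"
  shows "tiled m {\<tau>. \<tau> \<subset> \<rho>}"
  using assms
proof (induction \<rho> arbitrary: m rule: finite_induct)
  case (insert x \<rho>)
  have eq: "{\<tau>. \<tau> \<subset> insert x \<rho>} = {{}..\<rho>} \<union> insert x ` {\<tau>. \<tau> \<subset> \<rho>}"
  proof (intro equalityI subsetI)
    fix \<tau> assume \<tau>: "\<tau> \<in> {\<tau>. \<tau> \<subset> insert x \<rho>}"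
    show "\<tau> \<in> {{}..\<rho>} \<union> insert x ` {\<tau>. \<tau> \<subset> \<rho>}"
    proof (cases "x \<in> \<tau>")
      case True
      then have "\<tau> = insert x (\<tau> - {x})" "\<tau> - {x} \<subset> \<rho>" using \<tau> by auto
      then show ?thesis by blast
    qed (use \<tau> in auto)
  qed (use insert.hyps(2) in auto)
  have "tiled m (insert x ` {\<tau>. \<tau> \<subset> \<rho>})"
  proof (cases m)
    case 0
    then have "\<rho> = {}" using insert by simp
    then show ?thesis by (simp add: tiled_empty)
  next
    case (Suc l)
    then show ?thesis
      using insert by (auto intro!: tiled_insert_image[where W = \<rho>])
  qed
  moreover have "tiled m {{}..\<rho>}"
    using insert by (intro tiled_interval) auto
  ultimately show ?case
    unfolding eq using insert.hyps(2) by (intro tiled_Un) auto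
qed simp

section \<open>Cross-polytopes with and without the empty face\<close>

text \<open>The boundary complex of the \<open>k\<close>-dimensional cross-polytope: a face chooses, for each coordinate
  \<open>i < k\<close>, at most one of the two antipodal vertices \<open>v (i, True)\<close> and \<open>v (i, False)\<close>.\<close>

fun cross :: "(nat \<times> bool \<Rightarrow> 'a) \<Rightarrow> nat \<Rightarrow> 'a set set" where
  "cross v 0 = {{}}"
| "cross v (Suc k) = cross v k \<union> insert (v (k, True)) ` cross v k
     \<union> insert (v (k, False)) ` cross v k"

text \<open>Read a face as a word of signs and zeros, from coordinate \<open>k - 1\<close> down to coordinate \<open>0\<close>, and
  replace each zero by the sign before it, where \<open>a\<close> counts as the sign before the first letter. Then
  \<open>cross_part v k a c\<close> consists of the faces whose completion leaves the sign \<open>c\<close> at the end (for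
  \<open>k = 0\<close>, the sign at the end is \<open>a\<close> itself). In the recursion, the first letter is zero or \<open>a\<close>, and
  the current sign remains \<open>a\<close>, or it is the opposite sign, which becomes the current one.\<close>

fun cross_part :: "(nat \<times> bool \<Rightarrow> 'a) \<Rightarrow> nat \<Rightarrow> bool \<Rightarrow> bool \<Rightarrow> 'a set set" where
  "cross_part v 0 a c = (if a = c then {{}} else {})"
| "cross_part v (Suc k) a c = cross_part v k a c \<union> insert (v (k, a)) ` cross_part v k a c
     \<union> insert (v (k, \<not> a)) ` cross_part v k (\<not> a) c"

lemma cross_vertices: "cross v k \<subseteq> Pow (v ` ({..<k} \<times> UNIV))"
proof (induction k)
  case (Suc k)
  have "v ` ({..<k} \<times> UNIV) \<subseteq> v ` ({..<Suc k} \<times> UNIV)" by (intro image_mono) auto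
  with Suc have "cross v k \<subseteq> Pow (v ` ({..<Suc k} \<times> UNIV))" by blast
  then show ?case by auto
qed simp

lemma empty_in_cross: "{} \<in> cross v k"
  by (induction k) auto

lemma cross_mono: "cross v k \<subseteq> cross v (Suc k)"
  by auto

lemma cross_subset_closed: "e \<in> cross v k \<Longrightarrow> e' \<subseteq> e \<Longrightarrow> e' \<in> cross v k"
proof (induction k arbitrary: e e')
  case (Suc k)
  have *: "e' \<in> cross v k \<union> insert x ` cross v k" if "d \<in> cross v k" "e' \<subseteq> insert x d" for x d
  proof (cases "x \<in> e'")
    case True
    then have "e' = insert x (e' - {x})" "e' - {x} \<subseteq> d" using that by auto
    then show ?thesis using Suc.IH[OF that(1)] by blast
  next
    case False
    then show ?thesis using Suc.IH[OF that(1)] that(2) by (simp add: subset_insert)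
  qed
  then show ?case using Suc by fastforce
qed simp

lemma cross_part_Un: "cross_part v k a True \<union> cross_part v k a False = cross v k"
proof (induction k arbitrary: a)
  case (Suc k)
  have "cross_part v (Suc k) a True \<union> cross_part v (Suc k) a False =
    (cross_part v k a True \<union> cross_part v k a False)
    \<union> insert (v (k, a)) ` (cross_part v k a True \<union> cross_part v k a False)
    \<union> insert (v (k, \<not> a)) ` (cross_part v k (\<not> a) True \<union> cross_part v k (\<not> a) False)"
    by auto
  also have "\<dots> = cross v (Suc k)"
    unfolding Suc.IH by (cases a) (simp_all add: Un_ac)
  finally show ?case .
qed auto

lemma cross_part_subset: "cross_part v k a c \<subseteq> cross v k"
  using cross_part_Un[of v k a] by (metis (full_types) Un_upper1 Un_upper2)

text \<open>The zero word keeps the initial sign to the end, while the last sign of any other word does not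
  depend on the initial sign; this is the content of the next two lemmas.\<close>

lemma empty_in_cross_part: "{} \<in> cross_part v k a c \<longleftrightarrow> a = c"
  by (induction k arbitrary: a) auto

lemma cross_part_nonempty_faces: "cross_part v k (\<not> a) c - {{}} = cross_part v k a c - {{}}"
proof (induction k arbitrary: a)
  case (Suc k)
  have "cross_part v (Suc k) b c - {{}} = (cross_part v k b c - {{}})
      \<union> insert (v (k, b)) ` cross_part v k b c
      \<union> insert (v (k, \<not> b)) ` cross_part v k (\<not> b) c" for b
    by auto
  from this[of a] this[of "\<not> a"] show ?case
    by (simp only: Suc.IH not_not Un_ac)
qed auto

lemma fresh_vertex:
  fixes v :: "nat \<times> bool \<Rightarrow> 'a"
  assumes "inj v"
  shows "v (k, a) \<notin> v ` ({..<k} \<times> UNIV)"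
  using assms by (auto simp: inj_eq)

lemma insert_image_disjoint:
  assumes "A \<subseteq> Pow W" "B \<subseteq> Pow W" "x \<notin> W"
  shows "A \<inter> insert x ` B = {}" "insert x ` B \<inter> A = {}"
    and "x \<noteq> y \<Longrightarrow> insert x ` A \<inter> insert y ` B = {}"
    and "x \<noteq> y \<Longrightarrow> insert y ` A \<inter> insert x ` B = {}"
  using assms by auto

lemma cross_part_disjoint:
  assumes "inj v"
  shows "cross_part v k a True \<inter> cross_part v k a False = {}"
proof (induction k arbitrary: a)
  case (Suc k)
  let ?W = "v ` ({..<k} \<times> UNIV)"
  have sub: "cross_part v k a c \<subseteq> Pow ?W" for a c
    using cross_part_subset cross_vertices by blast
  have new: "v (k, a) \<notin> ?W" for a using fresh_vertex[OF assms] .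
  have neq: "v (k, a) \<noteq> v (k, \<not> a)" using assms by (auto dest: injD)
  have inj: "inj_on (insert x) (Pow ?W)" if "x \<notin> ?W" for x
    using that by (intro inj_onI) (subst (asm) insert_ident, auto)
  have same: "insert (v (k, b)) ` cross_part v k c True \<inter>
      insert (v (k, b)) ` cross_part v k c False = {}" for b c
    using inj_on_image_Int[OF inj[OF new[of b]] sub sub, of c True c False] Suc.IH[of c] by simp
  show ?case
    unfolding cross_part.simps Int_Un_distrib Int_Un_distrib2
    by (simp only: Suc.IH same insert_image_disjoint(1,2)[OF sub sub new]
        insert_image_disjoint(3)[OF sub sub new neq]
        insert_image_disjoint(4)[OF sub sub new neq] Un_empty_left)
qed auto

text \<open>The tiles are the sets of faces with the same completion. In the recursion, the faces that start
  with zero or with the current sign form a cone, and those that start with the opposite sign form a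
  cone without its base.\<close>

lemma tiled_cross_part:
  assumes "inj v"
  shows "tiled k (cross_part v k a c)"
proof (induction k arbitrary: a)
  case 0
  then show ?case using tiled_interval[of "{}" "{}" 0] by (auto intro: tiled_empty)
next
  case (Suc k)
  let ?W = "v ` ({..<k} \<times> UNIV)"
  have sub: "cross_part v k a c \<subseteq> Pow ?W" for a
    using cross_part_subset cross_vertices by blast
  have new: "v (k, a) \<notin> ?W" for a using fresh_vertex[OF assms] .
  have neq: "v (k, a) \<noteq> v (k, \<not> a)" using assms by (auto dest: injD)
  show ?case
    unfolding cross_part.simps
    using Suc.IH sub new insert_image_disjoint[OF sub sub new] neq
    by (intro tiled_Un[OF tiled_insert_image[where W = ?W] tiled_cone[where W = ?W]])
      (auto simp: Int_Un_distrib2)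
qed

lemma tiled_cross:
  assumes "inj v"
  shows "tiled k (cross v k)"
  unfolding cross_part_Un[of v k True, symmetric]
  using assms by (intro tiled_Un tiled_cross_part cross_part_disjoint)

text \<open>A nonempty face is given the initial sign opposite to its last sign. So the faces that end in
  \<open>c\<close> are those of \<open>cross_part v k (\<not> c) c\<close>, which does not contain the empty face.\<close>

lemma tiled_cross_minus_empty:
  assumes "inj v"
  shows "tiled k (cross v k - {{}})"
proof -
  have "cross v k - {{}} = cross_part v k False True \<union> cross_part v k True False"
    using cross_part_Un[of v k False] cross_part_nonempty_faces[of v k True False]
      empty_in_cross_part[of v k] by auto
  moreover have "cross_part v k False True \<inter> cross_part v k True False = {}"
    using cross_part_disjoint[OF assms, of k False] cross_part_nonempty_faces[of v k True False]
      empty_in_cross_part[of v k] by auto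
  ultimately show ?thesis
    using assms by (auto intro!: tiled_Un tiled_cross_part)
qed

section \<open>The gadget attached to a single face\<close>

text \<open>The second cross-polytope is one dimension smaller than the first, so that the facets of both
  joins have size \<open>n\<close>. The join with \<open>{\<rho>}\<close> is what allows \<open>\<rho>\<close> itself to be absorbed:
  it is the missing empty face of the second factor.\<close>

definition gadget :: "(nat \<times> bool \<Rightarrow> 'a) \<Rightarrow> nat \<Rightarrow> 'a set \<Rightarrow> 'a set set" where
  "gadget v n \<rho> = join {\<tau>. \<tau> \<subset> \<rho>} (cross v (Suc (n - card \<rho>)) - {{}})
     \<union> join {\<rho>} (cross v (n - card \<rho>) - {{}})"

lemma gadget_iff:
  "e \<in> gadget v n \<rho> \<longleftrightarrow> (\<exists>a b. e = a \<union> b \<and> b \<noteq> {} \<and>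
     (a \<subset> \<rho> \<and> b \<in> cross v (Suc (n - card \<rho>)) \<or> a = \<rho> \<and> b \<in> cross v (n - card \<rho>)))"
  unfolding gadget_def join_def by (auto simp del: cross.simps)

lemma gadget_vertices:
  assumes "e \<in> gadget v n \<rho>"
  shows "e \<subseteq> \<rho> \<union> range v" "e \<inter> range v \<noteq> {}"
proof -
  from assms obtain a b k where ab: "e = a \<union> b" "a \<subseteq> \<rho>" "b \<noteq> {}" "b \<in> cross v k"
    unfolding gadget_iff by (auto simp del: cross.simps)
  have "b \<subseteq> range v" using ab(4) cross_vertices[of v k] by blast
  with ab show "e \<subseteq> \<rho> \<union> range v" "e \<inter> range v \<noteq> {}" by auto
qed

text \<open>A face of \<open>{\<rho>} * (D - {{}})\<close> that loses a vertex of \<open>\<rho>\<close> moves to \<open>\<partial>\<rho> * (C - {{}})\<close>; this is where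
  the smaller cross-polytope must be part of the larger one.\<close>

lemma gadget_subset_closed:
  assumes "e \<in> gadget v n \<rho>" "e' \<subseteq> e"
  shows "e' \<subseteq> \<rho> \<or> e' \<in> gadget v n \<rho>"
proof -
  let ?C = "cross v (Suc (n - card \<rho>))" and ?D = "cross v (n - card \<rho>)"
  from assms(1) obtain a b where ab: "e = a \<union> b" "a \<subset> \<rho> \<and> b \<in> ?C \<or> a = \<rho> \<and> b \<in> ?D"
    unfolding gadget_iff by (elim exE conjE)
  define a' b' where "a' = e' \<inter> a" and "b' = e' \<inter> b"
  have e': "e' = a' \<union> b'" "a' \<subseteq> a" "b' \<subseteq> b"
    using assms(2) ab(1) by (auto simp: a'_def b'_def)
  have "a' \<subset> \<rho> \<and> b' \<in> ?C \<or> a' = \<rho> \<and> b' \<in> ?D"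
    using ab(2) e'(2,3) cross_subset_closed cross_mono by (metis psubsetI subset_iff subset_psubset_trans)
  moreover have "a' \<subseteq> \<rho>" using ab(2) e'(2) by auto
  ultimately show ?thesis
    unfolding gadget_iff using e'(1) by (cases "b' = {}") blast+
qed

lemma tiled_gadget:
  assumes "inj v" "finite \<rho>" "card \<rho> \<le> n" "\<rho> \<inter> range v = {}"
  shows "tiled n (gadget v n \<rho>)" "tiled n (gadget v n \<rho> \<union> {\<rho>})"
proof -
  let ?k = "n - card \<rho>"
  let ?C = "cross v (Suc ?k)" and ?D = "cross v ?k"
  have C: "?C \<subseteq> Pow (range v)" and D: "?D \<subseteq> Pow (range v)"
    using cross_vertices[of v] by blast+
  have bd: "tiled n (join {\<tau>. \<tau> \<subset> \<rho>} (?C - {{}}))"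
  proof (cases "card \<rho>")
    \<comment> \<open>The empty face has no proper subsets, so the join is empty.\<close>
    case 0
    then show ?thesis using assms(2) by (simp add: join_def tiled_empty)
  next
    case (Suc m)
    have "tiled (m + Suc ?k) (join {\<tau>. \<tau> \<subset> \<rho>} (?C - {{}}))"
      using assms C Suc
      by (intro tiled_join[of _ _ _ _ \<rho> "range v"] tiled_boundary tiled_cross_minus_empty) auto
    then show ?thesis using Suc assms(3) by simp
  qed
  have top: "tiled n (join {\<rho>} B)" if "tiled ?k B" "B \<subseteq> ?D" for B
  proof -
    have "tiled (card \<rho> + ?k) (join {\<rho>..\<rho>} B)"
      using assms D that
      by (intro tiled_join[of _ _ _ _ \<rho> "range v"] tiled_interval) auto
    then show ?thesis using assms(3) by simp
  qed
  have disj: "join {\<tau>. \<tau> \<subset> \<rho>} (?C - {{}}) \<inter> join {\<rho>} B = {}" if "B \<subseteq> ?D" for B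
    using assms(4) C D that by (intro join_disjoint[of _ _ \<rho> _ _ "range v"]) auto
  show "tiled n (gadget v n \<rho>)"
    unfolding gadget_def
    using assms(1) by (intro tiled_Un bd top disj tiled_cross_minus_empty) auto
  have "join {\<rho>} (?D - {{}}) \<union> {\<rho>} = join {\<rho>} ?D"
    using empty_in_cross[of v ?k] by (auto simp: join_def)
  then have "gadget v n \<rho> \<union> {\<rho>} = join {\<tau>. \<tau> \<subset> \<rho>} (?C - {{}}) \<union> join {\<rho>} ?D"
    unfolding gadget_def by auto
  then show "tiled n (gadget v n \<rho> \<union> {\<rho>})"
    using tiled_Un[OF top[OF tiled_cross[OF assms(1)] order.refl] bd disj[OF order.refl]]
    by simp
qed

section \<open>The extension\<close>

lemma fresh_vertices:
  assumes "infinite (UNIV :: 'a set)" "finite (V :: 'a set)" "finite I"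
  shows "\<exists>v :: 'i \<Rightarrow> nat \<times> bool \<Rightarrow> 'a. (\<forall>i. inj (v i) \<and> V \<inter> range (v i) = {}) \<and>
    disjoint_family_on (\<lambda>i. range (v i)) I"
proof -
  have "infinite (UNIV - V)" using Diff_infinite_finite[OF assms(2,1)] .
  then have "\<exists>g :: nat \<Rightarrow> 'a. inj g \<and> range g \<subseteq> UNIV - V"
    by (rule infinite_countable_subset)
  then obtain g :: "nat \<Rightarrow> 'a" where g: "inj g" "range g \<subseteq> UNIV - V"
    by (elim exE conjE)
  obtain c :: "'i \<Rightarrow> nat" where c: "inj_on c I"
    using finite_imp_inj_to_nat_seg[OF assms(3)] by blast
  define v where "v i p = g (to_nat (c i, p))" for i and p :: "nat \<times> bool"
  have "inj (v i) \<and> V \<inter> range (v i) = {}" for i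
    using g(2) by (auto simp: v_def inj_eq[OF g(1)] intro!: injI)
  moreover have "disjoint_family_on (\<lambda>i. range (v i)) I"
    by (auto simp: v_def disjoint_family_on_def inj_eq[OF g(1)] inj_on_eq_iff[OF c])
  ultimately show ?thesis by blast
qed

theorem theorem5p3:
  fixes \<Delta> :: "'a set set"
  assumes "infinite (UNIV :: 'a set)"
    and "finite_simplicial_complex \<Delta>"
    and "\<not> pure_complex \<Delta>"
  shows "\<exists>\<Gamma> :: 'a set set. finite_simplicial_complex \<Gamma> \<and> \<Delta> \<subseteq> \<Gamma> \<and>
           complex_dim \<Gamma> = complex_dim \<Delta> \<and>
           layer_compatibly_partitionable \<Gamma> \<and>
           layer_compatibly_partitionable (\<Gamma> - \<Delta>)"
proof -
  obtain V where V: "finite V" "\<Delta> \<subseteq> Pow V"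
    using assms(2) unfolding finite_simplicial_complex_def by auto
  have closed: "\<sigma> \<in> \<Delta>" if "\<tau> \<in> \<Delta>" "\<sigma> \<subseteq> \<tau>" for \<tau> \<sigma>
    using assms(2) that unfolding finite_simplicial_complex_def by simp
  have fin: "finite \<Delta>" using V by (meson finite_Pow_iff finite_subset)
  have fin_face: "finite \<rho>" if "\<rho> \<in> \<Delta>" for \<rho> using V that by (blast intro: finite_subset)
  have "\<Delta> \<noteq> {}" using assms(3) by (auto simp: pure_complex_def facets_def)
  define n where "n = Max (card ` \<Delta>)"
  have card_le: "card \<rho> \<le> n" if "\<rho> \<in> \<Delta>" for \<rho> using that fin by (simp add: n_def)
  have "n \<in> card ` \<Delta>" unfolding n_def using fin \<open>\<Delta> \<noteq> {}\<close> by (intro Max_in) auto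
  then obtain M where M: "M \<in> \<Delta>" "card M = n" by blast
  obtain v :: "'a set \<Rightarrow> nat \<times> bool \<Rightarrow> 'a"
    where v: "\<forall>\<rho>. inj (v \<rho>) \<and> V \<inter> range (v \<rho>) = {}"
      and v_disj: "disjoint_family_on (\<lambda>\<rho>. range (v \<rho>)) \<Delta>"
    using fresh_vertices[OF assms(1) V(1) fin] by (elim exE conjE)
  define G where "G \<rho> = gadget (v \<rho>) n \<rho>" for \<rho>
  define \<Gamma> where "\<Gamma> = \<Delta> \<union> (\<Union>\<rho>\<in>\<Delta>. G \<rho>)"
  have old: "\<rho> \<inter> range (v \<rho>') = {}" if "\<rho> \<in> \<Delta>" for \<rho> \<rho>' using that V(2) v by blast
  have tiled_G: "tiled n (G \<rho>)" "tiled n (G \<rho> \<union> {\<rho>})" if "\<rho> \<in> \<Delta>" for \<rho>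
    unfolding G_def
    using tiled_gadget[OF v[rule_format, THEN conjunct1] fin_face card_le old] that by auto
  \<comment> \<open>Every face of \<open>G \<rho>\<close> contains one of the new vertices that were chosen for \<open>\<rho>\<close>.\<close>
  have G_new: "G \<rho> \<inter> \<Delta> = {}" for \<rho>
    using gadget_vertices(2)[of _ "v \<rho>" n \<rho>] old unfolding G_def by blast
  have G_disj: "G \<rho> \<inter> G \<rho>' = {}" if "\<rho> \<in> \<Delta>" "\<rho>' \<in> \<Delta>" "\<rho> \<noteq> \<rho>'" for \<rho> \<rho>'
  proof -
    have "e \<notin> G \<rho>'" if "e \<in> G \<rho>" for e
    proof
      assume "e \<in> G \<rho>'"
      then have "e \<subseteq> \<rho>' \<union> range (v \<rho>')" unfolding G_def by (rule gadget_vertices)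
      moreover have "e \<inter> range (v \<rho>) \<noteq> {}"
        using \<open>e \<in> G \<rho>\<close> unfolding G_def by (rule gadget_vertices)
      ultimately show False
        using disjoint_family_onD[OF v_disj \<open>\<rho> \<in> \<Delta>\<close> \<open>\<rho>' \<in> \<Delta>\<close> \<open>\<rho> \<noteq> \<rho>'\<close>]
          old[OF \<open>\<rho>' \<in> \<Delta>\<close>, of \<rho>] by blast
    qed
    then show ?thesis by blast
  qed
  have "tiled n (\<Union>\<rho>\<in>\<Delta>. G \<rho> \<union> {\<rho>})"
  proof (intro tiled_UN)
    show "disjoint_family_on (\<lambda>\<rho>. G \<rho> \<union> {\<rho>}) \<Delta>"
      unfolding disjoint_family_on_def using G_disj G_new by blast
  qed (use fin tiled_G in auto)
  moreover have "(\<Union>\<rho>\<in>\<Delta>. G \<rho> \<union> {\<rho>}) = \<Gamma>" by (auto simp: \<Gamma>_def)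
  ultimately have tiled_\<Gamma>: "tiled n \<Gamma>" by simp
  have "tiled n (\<Union>\<rho>\<in>\<Delta>. G \<rho>)"
    using fin tiled_G G_disj by (intro tiled_UN) (auto simp: disjoint_family_on_def)
  moreover have "(\<Union>\<rho>\<in>\<Delta>. G \<rho>) = \<Gamma> - \<Delta>" using G_new by (auto simp: \<Gamma>_def)
  ultimately have tiled_rel: "tiled n (\<Gamma> - \<Delta>)" by simp
  have fin_\<Gamma>: "finite \<Gamma>" using tiled_partition[OF tiled_\<Gamma>] by simp
  have "\<sigma> \<in> \<Gamma>" if "\<tau> \<in> \<Gamma>" "\<sigma> \<subseteq> \<tau>" for \<sigma> \<tau>
  proof (cases "\<tau> \<in> \<Delta>")
    case True
    then show ?thesis using closed[OF True \<open>\<sigma> \<subseteq> \<tau>\<close>] by (simp add: \<Gamma>_def)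
  next
    case False
    then obtain \<rho> where "\<rho> \<in> \<Delta>" "\<tau> \<in> G \<rho>" using \<open>\<tau> \<in> \<Gamma>\<close> by (auto simp: \<Gamma>_def)
    moreover have "\<sigma> \<subseteq> \<rho> \<or> \<sigma> \<in> G \<rho>"
      using gadget_subset_closed \<open>\<tau> \<in> G \<rho>\<close> \<open>\<sigma> \<subseteq> \<tau>\<close> unfolding G_def by metis
    ultimately show ?thesis using closed[OF \<open>\<rho> \<in> \<Delta>\<close>] by (auto simp: \<Gamma>_def)
  qed
  moreover have "finite (\<Union>\<Gamma>)" "\<Gamma> \<subseteq> Pow (\<Union>\<Gamma>)"
    using fin_\<Gamma> tiled_card_le[OF tiled_\<Gamma>] by auto
  ultimately have complex: "finite_simplicial_complex \<Gamma>"
    unfolding finite_simplicial_complex_def by (intro conjI exI[of _ "\<Union>\<Gamma>"] ballI allI impI)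
  have dim: "complex_dim X = int n - 1"
    if "finite X" "\<And>e. e \<in> X \<Longrightarrow> card e \<le> n" "M \<in> X" for X
  proof -
    have "face_dim e \<le> int n - 1" if "e \<in> X" for e
      using \<open>\<And>e. e \<in> X \<Longrightarrow> card e \<le> n\<close>[OF that] by (simp add: face_dim_def)
    moreover have "face_dim M = int n - 1" using M(2) by (simp add: face_dim_def)
    ultimately show ?thesis
      unfolding complex_dim_def using \<open>finite X\<close> \<open>M \<in> X\<close>
      by (intro Max_eqI) (auto simp: rev_image_eqI)
  qed
  have sub: "\<Delta> \<subseteq> \<Gamma>" by (simp add: \<Gamma>_def)
  have "complex_dim \<Gamma> = int n - 1"
    using tiled_card_le[OF tiled_\<Gamma>] sub M(1) by (intro dim[OF fin_\<Gamma>]) auto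
  moreover have "complex_dim \<Delta> = int n - 1"
    by (rule dim[OF fin card_le M(1)])
  ultimately have "complex_dim \<Gamma> = complex_dim \<Delta>" by simp
  then show ?thesis
    using complex sub tiled_imp_layer_compatibly_partitionable[OF tiled_\<Gamma>]
      tiled_imp_layer_compatibly_partitionable[OF tiled_rel]
    by (intro exI[of _ \<Gamma>] conjI)
qed

end
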